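(* Let $n \ge 1$ and let $T_n = (t_{ij})_{0 \le i,j < n}$ be the $n \times n$ Boolean matrix with $t_{ij} = 1$ if $i < j$ and $t_{ij} = 0$ otherwise. Then every fractional covering of $T_n$ has cost at least $s(n) = n(\lfloor \log_2 n \rfloor + 2) - 2^{\lfloor \log_2 n \rfloor + 1}$.
   Context: For a Boolean $m\times n$ matrix $A$, a rectangle (1-rectangle) of $A$ is a pair $(R,C)$ with $R$ a set of row indices and $C$ a set of column indices such that $A_{ij}=1$ for all $(i,j)\in R\times C$; it covers the pairs in $R\times C$, and its cost is $|R|+|C|$. A fractional covering of $A$ is an assignment of a real number $x_{(R,C)}\in[0,1]$ to every rectangle $(R,C)$ of $A$ such that for every entry $(i,j)$ with $A_{ij}=1$ we have $\sum_{(R,C)\ni (i,j)} x_{(R,C)} \ge 1$ (sum over rectangles covering $(i,j)$). Its cost is $\sum_{(R,C)} (|R|+|C|)\, x_{(R,C)}$. *)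

theory Defs
  imports Complex_Main "Jordan_Normal_Form.Matrix"
begin

type_synonym rect = "nat set \<times> nat set"

text \<open>Row and column sets may be empty; rows and columns are indexed from 0.\<close>

definition rectangles :: "bool mat \<Rightarrow> rect set" where
  "rectangles A = {(R, C). R \<subseteq> {..<dim_row A} \<and> C \<subseteq> {..<dim_col A} \<and>
     (\<forall>i\<in>R. \<forall>j\<in>C. A $$ (i, j))}"

definition covers :: "rect \<Rightarrow> nat \<times> nat \<Rightarrow> bool" where
  "covers Q p \<longleftrightarrow> p \<in> fst Q \<times> snd Q"

definition rect_cost :: "rect \<Rightarrow> nat" where
  "rect_cost Q = card (fst Q) + card (snd Q)"

text \<open>The sums below range over finite sets, so they are genuine sums.\<close>

lemma finite_rectangles: "finite (rectangles A)"
  by (rule finite_subset[of _ "Pow {..<dim_row A} \<times> Pow {..<dim_col A}"])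
    (auto simp: rectangles_def)

text \<open>Values of \<open>x\<close> outside \<open>rectangles A\<close> are irrelevant.\<close>

definition fractional_covering :: "bool mat \<Rightarrow> (rect \<Rightarrow> real) \<Rightarrow> bool" where
  "fractional_covering A x \<longleftrightarrow>
     (\<forall>Q\<in>rectangles A. 0 \<le> x Q \<and> x Q \<le> 1) \<and>
     (\<forall>i<dim_row A. \<forall>j<dim_col A. A $$ (i, j) \<longrightarrow>
        (\<Sum>Q\<in>{Q \<in> rectangles A. covers Q (i, j)}. x Q) \<ge> 1)"

definition covering_cost :: "bool mat \<Rightarrow> (rect \<Rightarrow> real) \<Rightarrow> real" where
  "covering_cost A x = (\<Sum>Q\<in>rectangles A. real (rect_cost Q) * x Q)"

definition T_mat :: "nat \<Rightarrow> bool mat" where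
  "T_mat n = mat n n (\<lambda>(i, j). i < j)"

definition s :: "nat \<Rightarrow> real" where
  "s n = real n * (of_int \<lfloor>log 2 (real n)\<rfloor> + 2) - 2 powi (\<lfloor>log 2 (real n)\<rfloor> + 1)"

end

theory Submission
  imports Defs
begin

text \<open>
  The bound comes from linear programming duality. Give an entry with \<open>i < j\<close> weight 2 if
  \<open>j - i = 1\<close>, weight 1 if \<open>j - i\<close> is a larger power of 2, and weight 0 otherwise. The total
  weight is \<open>s n\<close>, so it suffices that no rectangle weighs more than its cost. Join \<open>i \<in> R\<close> to
  \<open>j \<in> C\<close> if \<open>j - i = 2 ^ k\<close>. If this edge were shortest neither at \<open>i\<close> nor at \<open>j\<close>, there would
  be edges \<open>(i, j')\<close> and \<open>(i', j)\<close> of length at most \<open>2 ^ (k - 1)\<close>, so that \<open>j' \<le> i'\<close>, which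
  is impossible in a rectangle. So every edge is the shortest one at one of its ends, an edge of
  length 1 is so at both ends, and each row and column has at most one shortest edge.
\<close>

definition pow2_edge :: "nat \<Rightarrow> nat \<Rightarrow> bool" where
  "pow2_edge i j \<longleftrightarrow> (\<exists>k. j = i + 2 ^ k)"

definition dual_weight :: "nat \<Rightarrow> nat \<Rightarrow> real" where
  "dual_weight i j = of_bool (pow2_edge i j) + of_bool (j = Suc i)"

lemma dual_weight_nonneg: "0 \<le> dual_weight i j"
  by (simp add: dual_weight_def)

lemma pow2_edge_less: "pow2_edge i j \<Longrightarrow> i < j"
  by (auto simp: pow2_edge_def)

text \<open>A smaller power of 2 is at most half of a larger one, so the end \<open>j'\<close> of a
  shorter edge from \<open>i\<close> does not pass the midpoint of \<open>i\<close> and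
  \<open>j\<close>. The next lemma is the mirror image at the other end.\<close>

lemma pow2_edge_shorter:
  assumes "pow2_edge i j" "pow2_edge i j'" "j' < j"
  shows "2 * j' \<le> i + j"
proof -
  obtain a b where ab: "j = i + 2 ^ a" "j' = i + 2 ^ b"
    using assms by (auto simp: pow2_edge_def)
  with assms(3) have "Suc b \<le> a"
    by simp
  then have "(2::nat) ^ Suc b \<le> 2 ^ a"
    by (intro power_increasing) auto
  then show ?thesis
    using ab by simp
qed

lemma pow2_edge_shorter':
  assumes "pow2_edge i j" "pow2_edge i' j" "i < i'"
  shows "i + j \<le> 2 * i'"
proof -
  obtain a b where ab: "j = i + 2 ^ a" "j = i' + 2 ^ b"
    using assms unfolding pow2_edge_def by blast
  with assms(3) have "(2::nat) ^ b < 2 ^ a"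
    by linarith
  then have "Suc b \<le> a"
    by simp
  then have "(2::nat) ^ Suc b \<le> 2 ^ a"
    by (intro power_increasing) auto
  then show ?thesis
    using ab by simp
qed

lemma sum_of_bool_unique_le_1:
  assumes "\<And>a b. a \<in> A \<Longrightarrow> b \<in> A \<Longrightarrow> P a \<Longrightarrow> P b \<Longrightarrow> a = b"
  shows "(\<Sum>a\<in>A. of_bool (P a)) \<le> (1::real)"
proof (cases "\<exists>a\<in>A. P a")
  case True
  then obtain a where "a \<in> A" "P a" by blast
  then have "{b \<in> A. P b} = {a}"
    using assms by blast
  then have "(\<Sum>b\<in>A. of_bool (P b)) \<le> real (card {a})"
    \<comment> \<open>For infinite \<open>A\<close> the sum is 0 by default.\<close>
    by (cases "finite A") (simp_all add: sum_of_bool_eq Int_def)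
  then show ?thesis by simp
next
  case False
  then have "(\<Sum>b\<in>A. of_bool (P b) :: real) = 0"
    by (intro sum.neutral) auto
  then show ?thesis by simp
qed

lemma dual_weight_rectangle_le:
  assumes "\<And>i j. i \<in> R \<Longrightarrow> j \<in> C \<Longrightarrow> i < j"
  shows "(\<Sum>i\<in>R. \<Sum>j\<in>C. dual_weight i j) \<le> real (card R + card C)"
proof -
  \<comment> \<open>\<open>P\<close> marks the shortest edge at row \<open>i\<close>, the one with
    the least column; \<open>Q\<close> marks the shortest edge at column \<open>j\<close>, the one
    with the greatest row.\<close>
  define P where "P i j \<longleftrightarrow> pow2_edge i j \<and> (\<forall>j'\<in>C. pow2_edge i j' \<longrightarrow> j \<le> j')" for i j
  define Q where "Q i j \<longleftrightarrow> pow2_edge i j \<and> (\<forall>i'\<in>R. pow2_edge i' j \<longrightarrow> i' \<le> i)" for i j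
  have le: "dual_weight i j \<le> of_bool (P i j) + of_bool (Q i j)" if "i \<in> R" "j \<in> C" for i j
  proof (cases "j = Suc i")
    case True
    have "pow2_edge i j"
      unfolding pow2_edge_def using True by (intro exI[of _ 0]) simp
    then have "P i j" "Q i j"
      using True by (auto simp: P_def Q_def dest: pow2_edge_less)
    then show ?thesis by (simp add: dual_weight_def)
  next
    case False
    have "P i j \<or> Q i j" if e: "pow2_edge i j"
    proof (rule ccontr)
      assume "\<not> (P i j \<or> Q i j)"
      then obtain i' j' where *: "j' \<in> C" "pow2_edge i j'" "j' < j"
          "i' \<in> R" "pow2_edge i' j" "i < i'"
        using e by (auto simp: P_def Q_def not_le)
      have "2 * j' \<le> 2 * i'"
        using pow2_edge_shorter[OF e *(2,3)] pow2_edge_shorter'[OF e *(5,6)] by linarith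
      with assms[OF *(4,1)] show False by simp
    qed
    with False show ?thesis by (auto simp: dual_weight_def)
  qed
  have "(\<Sum>i\<in>R. \<Sum>j\<in>C. dual_weight i j)
      \<le> (\<Sum>i\<in>R. \<Sum>j\<in>C. of_bool (P i j) + of_bool (Q i j))"
    by (intro sum_mono le)
  \<comment> \<open>Only the \<open>Q\<close> part is swapped: \<open>P\<close> holds at most once
    per row, \<open>Q\<close> at most once per column.\<close>
  also have "\<dots> = (\<Sum>i\<in>R. \<Sum>j\<in>C. of_bool (P i j)) + (\<Sum>j\<in>C. \<Sum>i\<in>R. of_bool (Q i j))"
    by (simp add: sum.distrib sum.swap[of _ C R])
  also have "\<dots> \<le> (\<Sum>i\<in>R. 1) + (\<Sum>j\<in>C. 1)"
    by (intro add_mono sum_mono sum_of_bool_unique_le_1) (auto simp: P_def Q_def intro: antisym)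
  finally show ?thesis by simp
qed

text \<open>The edges ending in \<open>n\<close> have the lengths 1, 2, ..., \<open>2 ^ L\<close>,
  and length 1 counts twice. This is the growth of the total weight from \<open>n\<close> to
  \<open>Suc n\<close>.\<close>

lemma dual_weight_column:
  assumes "2 ^ L \<le> n" "n < 2 ^ Suc L"
  shows "(\<Sum>i<n. dual_weight i n) = real L + 2"
proof -
  have "{i \<in> {..<n}. pow2_edge i n} = (\<lambda>k. n - 2 ^ k) ` {..L}"
  proof (intro equalityI subsetI)
    fix i assume "i \<in> {i \<in> {..<n}. pow2_edge i n}"
    then obtain k where k: "n = i + 2 ^ k" by (auto simp: pow2_edge_def)
    then have "(2::nat) ^ k < 2 ^ Suc L" using assms(2) by linarith
    then have "k < Suc L" by (rule power_less_imp_less_exp[rotated]) simp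
    then show "i \<in> (\<lambda>k. n - 2 ^ k) ` {..L}" using k by (intro image_eqI[of _ _ k]) auto
  next
    fix i assume "i \<in> (\<lambda>k. n - 2 ^ k) ` {..L}"
    then obtain k where k: "k \<le> L" "i = n - 2 ^ k" by auto
    then have "(2::nat) ^ k \<le> 2 ^ L" by (intro power_increasing) auto
    then have "2 ^ k \<le> n" using assms(1) by (rule order_trans)
    with k have "n = i + 2 ^ k" by simp
    then show "i \<in> {i \<in> {..<n}. pow2_edge i n}" by (auto simp: pow2_edge_def)
  qed
  moreover have "inj_on (\<lambda>k. n - 2 ^ k) {..L}"
  proof (rule inj_onI)
    fix k l assume "k \<in> {..L}" "l \<in> {..L}" and eq: "n - 2 ^ k = n - 2 ^ l"
    then have "(2::nat) ^ k \<le> 2 ^ L" "(2::nat) ^ l \<le> 2 ^ L"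
      by (auto intro: power_increasing)
    \<comment> \<open>Both powers are at most \<open>n\<close>, so neither subtraction is
      truncated.\<close>
    then have "(2::nat) ^ k = 2 ^ l" using eq assms(1) by linarith
    then show "k = l" by simp
  qed
  ultimately have card: "card {i \<in> {..<n}. pow2_edge i n} = Suc L"
    by (simp add: card_image)
  have "0 < n" using assms(1) by (metis not_gr_zero le_zero_eq power_not_zero zero_neq_numeral)
  then have "{i \<in> {..<n}. n = Suc i} = {n - 1}" by auto
  with card show ?thesis
    by (simp add: dual_weight_def sum.distrib sum_of_bool_eq Int_def)
qed

text \<open>Induction adds one column at a time. At \<open>n = 2 ^ Suc L\<close> the formulas for
  \<open>L\<close> and \<open>Suc L\<close> agree, which carries the induction past a power of
  2.\<close>

lemma dual_weight_total:
  assumes "1 \<le> n" "2 ^ L \<le> n" "n \<le> 2 ^ Suc L"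
  shows "(\<Sum>j<n. \<Sum>i<j. dual_weight i j) = real n * (real L + 2) - 2 ^ Suc L"
  using assms
proof (induction n arbitrary: L rule: nat_induct_at_least)
  case base
  then have "L = 0"
    using less_exp[of L] by linarith
  then show ?case by simp
next
  case (Suc n)
  show ?case
  proof (cases "2 ^ L \<le> n")
    case True
    then show ?thesis
      using Suc dual_weight_column[of L n] Suc.IH[of L] by (simp add: algebra_simps)
  next
    case False
    \<comment> \<open>The new size is exactly \<open>2 ^ L\<close>, but the added column
      \<open>n\<close> lies just below it and so has weight \<open>M + 2\<close> with
      \<open>M = L - 1\<close>.\<close>
    with Suc.prems have n: "Suc n = 2 ^ L" by simp
    with Suc.hyps obtain M where L: "L = Suc M" by (cases L) auto
    have pos: "(1::nat) \<le> 2 ^ M" by simp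
    then have M: "2 ^ M \<le> n" "n < 2 ^ Suc M" using n L by simp_all
    have real_n: "1 + real n = 2 * 2 ^ M"
      using arg_cong[OF n, of real] L by simp
    have "(\<Sum>j<Suc n. \<Sum>i<j. dual_weight i j) = (1 + real n) * (real M + 2) - 2 ^ Suc M"
      using Suc.IH[of M] M dual_weight_column[OF M] by (simp add: algebra_simps)
    also have "\<dots> = (1 + real n) * (real L + 2) - 2 ^ Suc L"
      unfolding real_n L by (simp add: algebra_simps)
    finally show ?thesis by simp
  qed
qed

lemma dual_weight_total_eq_s:
  assumes "1 \<le> n"
  shows "(\<Sum>j<n. \<Sum>i<j. dual_weight i j) = s n"
proof -
  obtain L where L: "2 ^ L \<le> n" "n < 2 ^ Suc L"
    using ex_power_ivl1[of 2 n] assms by auto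
  have "\<lfloor>log 2 (real n)\<rfloor> = int L"
    using floor_log_nat_eq_if[of 2 L n] L by simp
  then have "s n = real n * (real L + 2) - 2 powi int (Suc L)"
    by (simp add: s_def add.commute)
  then show ?thesis
    using dual_weight_total[OF assms L(1)] L(2) by (simp only: power_int_of_nat)
qed

text \<open>Weak duality: \<open>w\<close> is a feasible solution of the dual packing program. Every
  1-entry is covered with total at least 1, so its weight can only grow when multiplied by that
  total; regrouping by rectangles then compares weights with costs.\<close>

lemma covering_cost_ge_dual:
  assumes cov: "fractional_covering A x"
    and nonneg: "\<And>i j. 0 \<le> w i j"
    and le: "\<And>R C. (R, C) \<in> rectangles A \<Longrightarrow> (\<Sum>i\<in>R. \<Sum>j\<in>C. w i j) \<le> real (card R + card C)"
  shows "(\<Sum>(i, j)\<in>{(i, j). i < dim_row A \<and> j < dim_col A \<and> A $$ (i, j)}. w i j)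
    \<le> covering_cost A x"
proof -
  let ?E = "{(i, j). i < dim_row A \<and> j < dim_col A \<and> A $$ (i, j)}"
  have finE: "finite ?E"
    by (rule finite_subset[of _ "{..<dim_row A} \<times> {..<dim_col A}"]) auto
  have Q: "(\<Sum>p\<in>{p \<in> ?E. covers Q p}. case_prod w p) \<le> real (rect_cost Q)"
    if "Q \<in> rectangles A" for Q
  proof -
    obtain R C where RC: "Q = (R, C)" by (cases Q)
    have "{p \<in> ?E. covers Q p} = R \<times> C"
      using that by (auto simp: RC rectangles_def covers_def)
    then show ?thesis
      using le[of R C] that by (simp add: RC rect_cost_def sum.cartesian_product)
  qed
  have "(\<Sum>p\<in>?E. case_prod w p)
      \<le> (\<Sum>p\<in>?E. case_prod w p * (\<Sum>Q\<in>{Q \<in> rectangles A. covers Q p}. x Q))"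
  proof (rule sum_mono)
    fix p assume "p \<in> ?E"
    then have "1 \<le> (\<Sum>Q\<in>{Q \<in> rectangles A. covers Q p}. x Q)"
      using cov by (auto simp: fractional_covering_def)
    moreover have "0 \<le> case_prod w p"
      by (simp add: nonneg split: prod.split)
    ultimately show "case_prod w p \<le> case_prod w p * (\<Sum>Q\<in>{Q \<in> rectangles A. covers Q p}. x Q)"
      using mult_left_mono[of 1 _ "case_prod w p"] by auto
  qed
  also have "\<dots> = (\<Sum>Q\<in>rectangles A. \<Sum>p\<in>{p \<in> ?E. covers Q p}. case_prod w p * x Q)"
    by (simp only: sum_distrib_left sum.swap_restrict[OF finE finite_rectangles])
  also have "\<dots> = (\<Sum>Q\<in>rectangles A. (\<Sum>p\<in>{p \<in> ?E. covers Q p}. case_prod w p) * x Q)"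
    by (simp only: sum_distrib_right)
  also have "\<dots> \<le> (\<Sum>Q\<in>rectangles A. real (rect_cost Q) * x Q)"
    using cov by (intro sum_mono mult_right_mono Q) (auto simp: fractional_covering_def)
  finally show ?thesis by (simp add: covering_cost_def)
qed

theorem theorem4:
  fixes n :: nat and x :: "rect \<Rightarrow> real"
  assumes "n \<ge> 1"
    and "fractional_covering (T_mat n) x"
  shows "covering_cost (T_mat n) x \<ge> s n"
proof -
  let ?E = "{(i, j). i < dim_row (T_mat n) \<and> j < dim_col (T_mat n) \<and> T_mat n $$ (i, j)}"
  have "s n = (\<Sum>(j, i)\<in>(SIGMA j:{..<n}. {..<j}). dual_weight i j)"
    using assms(1) by (simp add: dual_weight_total_eq_s[symmetric] sum.Sigma)
  \<comment> \<open>The total was computed column by column, so its index pairs are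
    transposed.\<close>
  also have "\<dots> = (\<Sum>(i, j)\<in>?E. dual_weight i j)"
    by (rule sum.reindex_bij_witness[of _ prod.swap prod.swap]) (auto simp: T_mat_def)
  also have "\<dots> \<le> covering_cost (T_mat n) x"
  proof (rule covering_cost_ge_dual[OF assms(2) dual_weight_nonneg])
    fix R C assume "(R, C) \<in> rectangles (T_mat n)"
    then have "i < j" if "i \<in> R" "j \<in> C" for i j
      using that by (fastforce simp: rectangles_def T_mat_def)
    then show "(\<Sum>i\<in>R. \<Sum>j\<in>C. dual_weight i j) \<le> real (card R + card C)"
      by (rule dual_weight_rectangle_le)
  qed
  finally show ?thesis .
qed

end
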